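(* As $n\to\infty$, $$h(n!)\;\le\;(2\log 2+o(1))\,\frac{n}{\log n}.$$ That is, for every $\delta>0$ there is $n_0$ such that for all integers $n\ge n_0$ one has $h(n!)\le (2\log 2+\delta)\,\dfrac{n}{\log n}$.
   Context: $\log$ denotes the natural logarithm. An integer $N\ge 1$ is called practical if every integer $1\le m\le N$ is a sum of distinct (positive) divisors of $N$. For practical $N$, $$h(N)=\min\{k:\ \text{every integer } 1\le m\le N \text{ is a sum of at most } k \text{ distinct divisors of } N\}.$$ For every $n\ge 1$ the integer $n!$ is practical (a known fact; indeed Erdős proved $h(n!)\le n$), so $h(n!)$ is defined. *)

theory Defs
  imports Complex_Main
begin

definition practical :: "nat \<Rightarrow> bool" where
  "practical N \<longleftrightarrow> N \<ge> 1 \<and>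
     (\<forall>m. 1 \<le> m \<and> m \<le> N \<longrightarrow> (\<exists>D. D \<subseteq> {d. d dvd N} \<and> \<Sum>D = m))"

text \<open>The value of \<open>h N\<close> is meaningful only for practical \<open>N\<close>: see \<open>h_works\<close> and \<open>h_le\<close>.\<close>

definition h :: "nat \<Rightarrow> nat" where
  "h N = (LEAST k. \<forall>m. 1 \<le> m \<and> m \<le> N \<longrightarrow>
            (\<exists>D. D \<subseteq> {d. d dvd N} \<and> card D \<le> k \<and> \<Sum>D = m))"

lemma h_works:
  assumes "practical N" "1 \<le> m" "m \<le> N"
  shows "\<exists>D. D \<subseteq> {d. d dvd N} \<and> card D \<le> h N \<and> \<Sum>D = m"
proof -
  have "finite {d. d dvd N}"
    using assms(1) by (simp add: practical_def)
  then have "\<forall>m. 1 \<le> m \<and> m \<le> N \<longrightarrow>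
      (\<exists>D. D \<subseteq> {d. d dvd N} \<and> card D \<le> card {d. d dvd N} \<and> \<Sum>D = m)"
    using assms(1) unfolding practical_def by (meson card_mono)
  then have "\<forall>m. 1 \<le> m \<and> m \<le> N \<longrightarrow>
      (\<exists>D. D \<subseteq> {d. d dvd N} \<and> card D \<le> h N \<and> \<Sum>D = m)"
    unfolding h_def by (rule LeastI)
  then show ?thesis using assms by blast
qed

lemma h_le:
  assumes "\<And>m. 1 \<le> m \<Longrightarrow> m \<le> N \<Longrightarrow> \<exists>D. D \<subseteq> {d. d dvd N} \<and> card D \<le> k \<and> \<Sum>D = m"
  shows "h N \<le> k"
  unfolding h_def by (rule Least_le) (use assms in blast)

lemma practical_fact: "practical (fact n)"
proof (induction n)
  case 0
  show ?case
    unfolding practical_def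
  proof (intro conjI allI impI)
    fix m :: nat assume "1 \<le> m \<and> m \<le> fact 0"
    then show "\<exists>D. D \<subseteq> {d. d dvd fact 0} \<and> \<Sum>D = m"
      by (intro exI[of _ "{1}"]) auto
  qed simp
next
  case (Suc n)
  show ?case
    unfolding practical_def
  proof (intro conjI allI impI)
    show "1 \<le> (fact (Suc n) :: nat)" by (rule fact_ge_1)
  next
    fix m :: nat assume m: "1 \<le> m \<and> m \<le> fact (Suc n)"
    define q r where "q = m div Suc n" and "r = m mod Suc n"
    have m_eq: "m = Suc n * q + r" unfolding q_def r_def by (simp only: mult_div_mod_eq)
    have r: "r \<le> n" unfolding r_def by (simp add: less_Suc_eq_le[symmetric])
    have "q \<le> Suc n * fact n div Suc n"
      unfolding q_def using m by (intro div_le_mono) simp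
    then have "q \<le> fact n" by (simp only: nonzero_mult_div_cancel_left)
    have "\<exists>D. D \<subseteq> {d. d dvd fact n} \<and> \<Sum>D = q"
    proof (cases "q = 0")
      case True
      then show ?thesis by (intro exI[of _ "{}"]) simp
    next
      case False
      then have "1 \<le> q" by simp
      with \<open>q \<le> fact n\<close> Suc.IH show ?thesis
        unfolding practical_def by blast
    qed
    then obtain D where D: "D \<subseteq> {d. d dvd fact n}" "\<Sum>D = q"
      by blast
    have fin: "finite D"
      using D(1) by (rule finite_subset) simp
    define E where "E = (*) (Suc n) ` D"
    have E: "E \<subseteq> {d. d dvd fact (Suc n)}"
      using D(1) unfolding E_def by (auto simp del: mult_Suc simp: fact_Suc intro!: mult_dvd_mono)
    have sumE: "\<Sum>E = Suc n * q"
      unfolding E_def using D(2)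
      by (subst sum.reindex) (auto simp: inj_on_def sum_distrib_left simp del: mult_Suc)
    show "\<exists>D. D \<subseteq> {d. d dvd fact (Suc n)} \<and> \<Sum>D = m"
    proof (cases "r = 0")
      case True
      then show ?thesis using E sumE m_eq by auto
    next
      case False
      have "r \<notin> E"
      proof
        assume "r \<in> E"
        then have "Suc n dvd r" unfolding E_def by (auto simp del: mult_Suc)
        then show False using False r by (auto dest: dvd_imp_le)
      qed
      moreover have "r dvd fact (Suc n)"
        using False r by (intro dvd_fact) auto
      moreover have "finite E" unfolding E_def using fin by simp
      ultimately show ?thesis
        using E sumE m_eq by (intro exI[of _ "insert r E"]) auto
    qed
  qed
qed

end

theory Submission
  imports Defs "HOL-Real_Asymp.Real_Asymp"
begin

text \<open>
  The idea is to subtract divisors of \<open>n!\<close> greedily. If every \<open>m\<close> in the relevant range has a divisor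
  \<open>d \<le> m\<close> of \<open>n!\<close> with \<open>m - d \<le> \<epsilon> * m\<close>, then about \<open>ln (n!) / ln (1 / \<epsilon>)\<close> divisors suffice.
  As \<open>ln (n!)\<close> is at most \<open>n * ln n\<close>, the constant \<open>2 * ln 2\<close> results from
  \<open>ln (1 / \<epsilon>) = (1 - o(1)) * (ln n)\<^sup>2 / (2 * ln 2)\<close>.

  Such dense divisors come from the Thue--Morse sequence. Split \<open>2 ^ k\<close> consecutive integers
  near \<open>x\<close> into two classes according to the parity of the binary digit sum of the offset. The
  logarithm of the quotient of the two products is an iterated difference of \<open>ln\<close> of order
  \<open>k\<close> with steps \<open>1, 2, \<dots>, 2 ^ (k - 1)\<close>, hence of size about
  \<open>(k - 1)! * 2 ^ (k * (k - 1) / 2) / x ^ k\<close>. With \<open>2 ^ k\<close> and \<open>x\<close> close to \<open>n\<close> (up to powers of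
  \<open>ln n\<close>), this is \<open>2 ^ (- k\<^sup>2 / 2)\<close> up to lower order terms in the exponent, which is the required
  precision. When \<open>k\<close> and \<open>x\<close> vary, the quotients meet every dyadic scale from \<open>1 / 2\<close> down to
  this one (\<open>log_diff_hits\<close>). About \<open>(ln n)\<^sup>2\<close> such pairs of classes are needed. They are made
  disjoint by dilating each one into a residue class of its own, which costs only a power of \<open>ln n\<close>.
  Exchanging one class of a pair for the other in a product of distinct integers up to \<open>n\<close> gives
  another divisor of \<open>n!\<close>, so \<open>n!\<close> has a divisor close to any number that is not too near the ends
  of \<open>[1, n!]\<close> (\<open>divisor_of_fact_near\<close>).

  Near both ends of \<open>[1, n!]\<close> binary digits are enough, since \<open>n!\<close> is divisible by a large power of
  two and the ends have logarithmic length \<open>o (n / ln n)\<close> (\<open>h_le_of_dense_divisors\<close>).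
\<close>

section \<open>Iterated differences of the logarithm\<close>

text \<open>
  The steps are \<open>1, 2, 4, \<dots>\<close> because they are the smallest ones whose subset sums are
  pairwise distinct: unfolded, the difference of order \<open>k\<close> is the sum of \<open>f\<close> over
  \<open>2 ^ k\<close> consecutive points, with the signs of the Thue--Morse sequence.
\<close>

primrec dyadic_diff :: "nat \<Rightarrow> (real \<Rightarrow> real) \<Rightarrow> real \<Rightarrow> real" where
  "dyadic_diff 0 f x = f x"
| "dyadic_diff (Suc k) f x = dyadic_diff k f x - dyadic_diff k f (x + 2 ^ k)"

lemma dyadic_diff_linear:
  "dyadic_diff k (\<lambda>y. a * f y + b * f (y + t)) x =
     a * dyadic_diff k f x + b * dyadic_diff k f (x + t)"
  by (induction k arbitrary: x) (simp_all add: algebra_simps)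

lemma dyadic_diff_const: "k \<ge> 1 \<Longrightarrow> dyadic_diff k (\<lambda>_. c) x = 0"
proof (induction k arbitrary: x)
  case (Suc k)
  then show ?case by (cases "k = 0") auto
qed simp

text \<open>
  Each differencing step \<open>f x - f (x + t)\<close> with \<open>t > 0\<close> acts, by the mean value theorem,
  like \<open>-t\<close> times a derivative. The sign of the \<open>k\<close>-th derivative (\<open>g k\<close> in the tower
  \<open>g\<close> of derivatives of \<open>g 0\<close>) therefore controls the sign of the difference. Linear
  inequalities between differences become pointwise inequalities between derivatives.
\<close>

lemma dyadic_diff_nonneg:
  assumes "x > 0"
    and "\<And>j y. j < k \<Longrightarrow> y > 0 \<Longrightarrow> (g j has_real_derivative g (Suc j) y) (at y)"
    and "\<And>y. x \<le> y \<Longrightarrow> y \<le> x + 2 ^ k \<Longrightarrow> (-1) ^ k * g k y \<ge> 0"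
  shows "dyadic_diff k (g 0) x \<ge> 0"
  using assms
proof (induction k arbitrary: g)
  case 0
  then show ?case by simp
next
  case (Suc k)
  \<comment> \<open>the last differencing step, moved inside, so that order \<open>k\<close> remains\<close>
  define g' where "g' = (\<lambda>j y. 1 * g j y + (- 1) * g j (y + 2 ^ k))"
  have "dyadic_diff k (g' 0) x \<ge> 0"
  proof (rule Suc.IH)
    show "x > 0" by fact
  next
    fix j y assume j: "j < k" and y: "(y::real) > 0"
    have 1: "(g j has_real_derivative g (Suc j) y) (at y)"
      using Suc.prems(2) j y by simp
    have "(g j has_real_derivative g (Suc j) (y + 2 ^ k)) (at (y + 2 ^ k))"
      using Suc.prems(2)[of j "y + 2 ^ k"] j y by (simp add: add_pos_pos)
    then have "((\<lambda>y. g j (y + 2 ^ k)) has_real_derivative g (Suc j) (y + 2 ^ k)) (at y)"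
      by (simp add: DERIV_shift)
    with 1 show "(g' j has_real_derivative g' (Suc j) y) (at y)"
      unfolding g'_def by (auto intro!: derivative_eq_intros)
  next
    fix y assume y: "x \<le> y" "y \<le> x + 2 ^ k"
    have "\<exists>z>y. z < y + 2 ^ k \<and>
        g k (y + 2 ^ k) - g k y = (y + 2 ^ k - y) * g (Suc k) z"
      by (rule MVT2) (use Suc.prems(1,2) y in auto)
    then obtain z where z: "y < z" "z < y + 2 ^ k"
      and eq: "g k (y + 2 ^ k) - g k y = 2 ^ k * g (Suc k) z" by auto
    have "(-1) ^ k * g' k y = 2 ^ k * ((-1) ^ Suc k * g (Suc k) z)"
      using eq by (simp add: g'_def algebra_simps)
    also have "\<dots> \<ge> 0"
      using Suc.prems(3)[of z] y z by (intro mult_nonneg_nonneg[OF _ Suc.prems(3)]) auto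
    finally show "(-1) ^ k * g' k y \<ge> 0" .
  qed
  then show ?case
    unfolding g'_def dyadic_diff_linear by simp
qed

text \<open>
  For \<open>k \<ge> 1\<close> this is the logarithm of a quotient of two products of \<open>2 ^ (k - 1)\<close> numbers near
  \<open>x\<close>. The sign is chosen so that it is positive. Its size is about
  \<open>fact (k - 1) * 2 ^ (k * (k - 1) div 2) / x ^ k\<close> when \<open>x\<close> is large compared with \<open>k * 2 ^ k\<close>.
\<close>

definition log_diff :: "nat \<Rightarrow> real \<Rightarrow> real" where
  "log_diff k = dyadic_diff k (\<lambda>y. - ln y)"

lemma log_diff_Suc: "log_diff (Suc k) x = log_diff k x - log_diff k (x + 2 ^ k)"
  by (simp add: log_diff_def)

lemma log_diff_1: "log_diff (Suc 0) x = ln (x + 1) - ln x"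
  by (simp add: log_diff_def)

text \<open>
  Up to the common factor \<open>fact (k - 1)\<close>, the \<open>k\<close>-th derivatives of the two terms are
  \<open>a / y ^ k\<close> and \<open>b / (y + t) ^ k\<close>.
\<close>

lemma log_diff_combination_nonneg:
  assumes "k \<ge> 1" "x > 0" "t \<ge> 0"
    and "\<And>y. x \<le> y \<Longrightarrow> y \<le> x + 2 ^ k \<Longrightarrow> a / y ^ k + b / (y + t) ^ k \<ge> 0"
  shows "a * log_diff k x + b * log_diff k (x + t) \<ge> 0"
proof -
  define L :: "nat \<Rightarrow> real \<Rightarrow> real" where
    "L = (\<lambda>j y. if j = 0 then - ln y else (-1) ^ j * fact (j - 1) * inverse y ^ j)"
  have der: "(L j has_real_derivative L (Suc j) y) (at y)" if "y > 0" for j y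
  proof (cases j)
    case 0
    then show ?thesis
      using that unfolding L_def by (auto intro!: derivative_eq_intros simp: divide_simps)
  next
    case (Suc i)
    have "((\<lambda>y. (- 1) ^ Suc i * fact i * inverse y ^ Suc i) has_real_derivative
        (- 1) ^ Suc i * fact i * (real (Suc i) * inverse y ^ i * (- (inverse y * inverse y)))) (at y)"
      using that DERIV_cmult[OF DERIV_power[OF DERIV_inverse], of y "(- 1) ^ Suc i * fact i" "Suc i" UNIV]
      by (simp add: mult_ac)
    also have "(- 1) ^ Suc i * fact i * (real (Suc i) * inverse y ^ i * (- (inverse y * inverse y)))
        = (- 1) ^ Suc (Suc i) * fact (Suc i) * inverse y ^ Suc (Suc i)"
      by (simp add: algebra_simps)
    finally show ?thesis by (simp add: L_def Suc)
  qed
  define g where "g = (\<lambda>j y. a * L j y + b * L j (y + t))"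
  have "dyadic_diff k (g 0) x \<ge> 0"
  proof (rule dyadic_diff_nonneg)
    fix j and y :: real assume y: "y > 0"
    have "(L j has_real_derivative L (Suc j) (y + t)) (at (y + t))"
      using der[of "y + t" j] y assms(3) by simp
    then have "((\<lambda>y. L j (y + t)) has_real_derivative L (Suc j) (y + t)) (at y)"
      by (simp add: DERIV_shift)
    with der[OF y, of j] show "(g j has_real_derivative g (Suc j) y) (at y)"
      unfolding g_def by (auto intro!: derivative_eq_intros)
  next
    fix y assume y: "x \<le> y" "y \<le> x + 2 ^ k"
    have "(-1) ^ k * g k y = fact (k - 1) * (a / y ^ k + b / (y + t) ^ k)"
      using assms(1)
      by (simp add: g_def L_def algebra_simps divide_inverse power_inverse flip: power_add mult_2)
    also have "\<dots> \<ge> 0"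
      using assms(4)[OF y] by simp
    finally show "(-1) ^ k * g k y \<ge> 0" .
  qed (use assms in auto)
  then show ?thesis
    unfolding g_def dyadic_diff_linear by (simp add: log_diff_def L_def)
qed

text \<open>
  The ratio of the derivatives at \<open>y + t\<close> and \<open>y\<close>, which is \<open>(y / (y + t)) ^ k\<close>, increases
  with \<open>y\<close>. Its values at the two ends of the interval \<open>{x..x + 2 ^ k}\<close> bound the ratio of
  the differences, from below here and from above in the next lemma.
\<close>

lemma log_diff_shift_ge:
  assumes "k \<ge> 1" "x > 0" "t \<ge> 0"
  shows "(x / (x + t)) ^ k * log_diff k x \<le> log_diff k (x + t)"
proof -
  have "- ((x / (x + t)) ^ k) * log_diff k x + 1 * log_diff k (x + t) \<ge> 0"
  proof (rule log_diff_combination_nonneg[OF assms])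
    fix y assume y: "x \<le> y"
    have "x / (x + t) \<le> y / (y + t)"
      using y assms by (simp add: divide_simps) (simp add: algebra_simps mult_left_mono)
    then have "(x / (x + t)) ^ k \<le> (y / (y + t)) ^ k"
      using assms by (intro power_mono) auto
    then have "(x / (x + t)) ^ k / y ^ k \<le> (y / (y + t)) ^ k / y ^ k"
      using y assms by (intro divide_right_mono) auto
    also have "\<dots> = 1 / (y + t) ^ k"
      using y assms by (simp add: power_divide)
    finally show "- ((x / (x + t)) ^ k) / y ^ k + 1 / (y + t) ^ k \<ge> 0" by simp
  qed
  then show ?thesis by simp
qed

lemma log_diff_shift_le:
  assumes "k \<ge> 1" "x > 0" "t \<ge> 0"
  shows "log_diff k (x + t) \<le> ((x + 2 ^ k) / (x + 2 ^ k + t)) ^ k * log_diff k x"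
proof -
  define w where "w = x + 2 ^ k"
  have "(w / (w + t)) ^ k * log_diff k x + (- 1) * log_diff k (x + t) \<ge> 0"
  proof (rule log_diff_combination_nonneg[OF assms])
    fix y assume y: "x \<le> y" "y \<le> x + 2 ^ k"
    then have yw: "0 < y" "y \<le> w" "0 < w" using assms by (auto simp: w_def)
    have "y / (y + t) \<le> w / (w + t)"
      using yw assms by (simp add: divide_simps) (simp add: algebra_simps mult_left_mono)
    then have "(y / (y + t)) ^ k \<le> (w / (w + t)) ^ k"
      using yw assms by (intro power_mono) auto
    then have "(y / (y + t)) ^ k / y ^ k \<le> (w / (w + t)) ^ k / y ^ k"
      using yw by (intro divide_right_mono) auto
    moreover have "(y / (y + t)) ^ k / y ^ k = 1 / (y + t) ^ k"
      using yw by (simp add: power_divide)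
    ultimately show "(w / (w + t)) ^ k / y ^ k + (- 1) / (y + t) ^ k \<ge> 0" by simp
  qed
  then show ?thesis by (simp add: w_def)
qed

text \<open>
  In the recursion the subtracted term is a fraction below one of the other term.
\<close>

lemma log_diff_pos:
  assumes "k \<ge> 1" "x > 0"
  shows "log_diff k x > 0"
  using assms
proof (induction k rule: dec_induct)
  case base
  then show ?case by (simp add: log_diff_1)
next
  case (step k)
  let ?c = "((x + 2 ^ k) / (x + 2 ^ k + 2 ^ k)) ^ k"
  have "?c < 1"
    using step by (subst power_less_one_iff) (auto simp: divide_simps add_pos_pos)
  then have "?c * log_diff k x < 1 * log_diff k x"
    using step by (intro mult_strict_right_mono) auto
  moreover have "log_diff k (x + 2 ^ k) \<le> ?c * log_diff k x"
    using step by (intro log_diff_shift_le) auto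
  ultimately show ?case
    by (simp add: log_diff_Suc)
qed

lemma log_diff_shift_ge_Bernoulli:
  assumes "k \<ge> 1" "x > 0" "t \<ge> 0"
  shows "(1 - real k * t / (x + t)) * log_diff k x \<le> log_diff k (x + t)"
proof -
  have "1 + real k * (- t / (x + t)) \<le> (1 + (- t / (x + t))) ^ k"
    by (rule Bernoulli_inequality) (use assms in \<open>auto simp: divide_simps\<close>)
  also have "1 + (- t / (x + t)) = x / (x + t)"
    using assms by (simp add: divide_simps)
  finally have "(1 - real k * t / (x + t)) * log_diff k x \<le> (x / (x + t)) ^ k * log_diff k x"
    using log_diff_pos[OF assms(1,2)] by (intro mult_right_mono) auto
  with log_diff_shift_ge[OF assms] show ?thesis by linarith
qed

section \<open>The range of values of the differences\<close>

text \<open>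
  By the Bernoulli form of the lower bound, raising the order from \<open>k\<close> to \<open>k + 1\<close> gains the
  factor \<open>k * 2 ^ k / x\<close>. The extra factor \<open>K\<close> in the size of \<open>x\<close> is there to absorb \<open>k\<close>.
\<close>

lemma log_diff_le_prod:
  assumes "1 \<le> k" "k \<le> K" "x \<ge> real K * 2 ^ K"
  shows "log_diff k x \<le> (\<Prod>i<k. 2 ^ i / 2 ^ K)"
  using assms
proof (induction k rule: dec_induct)
  case base
  then have "1 \<le> real K" by simp
  have "(2::real) ^ K \<le> real K * 2 ^ K" using \<open>1 \<le> real K\<close> by simp
  then have x: "x \<ge> 2 ^ K" using base by linarith
  have x0: "x > 0" using x by (rule less_le_trans[rotated]) simp
  have "ln (x + 1) - ln x = ln (1 + 1 / x)"
    using x0 by (subst ln_divide_pos[symmetric]) (auto simp: add_divide_distrib)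
  also have "\<dots> \<le> 1 / x"
    using x0 by (intro ln_add_one_self_le_self) auto
  also have "\<dots> \<le> 1 / 2 ^ K"
    using x x0 by (intro divide_left_mono) auto
  finally show ?case by (simp add: log_diff_1)
next
  case (step k)
  have x0: "x > 0"
    using step by (intro less_le_trans[OF _ \<open>x \<ge> real K * 2 ^ K\<close>]) auto
  have pos: "log_diff k x > 0"
    using log_diff_pos step x0 by simp
  have "log_diff (Suc k) x \<le> real k * 2 ^ k / (x + 2 ^ k) * log_diff k x"
    using log_diff_shift_ge_Bernoulli[of k x "2 ^ k"] step x0
    by (simp add: log_diff_Suc algebra_simps)
  also have "\<dots> \<le> 2 ^ k / 2 ^ K * log_diff k x"
  proof (intro mult_right_mono)
    have "real k * 2 ^ k * 2 ^ K \<le> 2 ^ k * (real K * 2 ^ K)"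
      using step by simp
    also have "\<dots> \<le> 2 ^ k * (x + 2 ^ k)"
      using step by (intro mult_left_mono) (auto intro: order_trans)
    finally show "real k * 2 ^ k / (x + 2 ^ k) \<le> 2 ^ k / 2 ^ K"
      using x0 by (simp add: divide_simps add_pos_pos)
  qed (use pos in auto)
  also have "\<dots> \<le> 2 ^ k / 2 ^ K * (\<Prod>i<k. 2 ^ i / 2 ^ K)"
    using step by (intro mult_left_mono) auto
  finally show ?case by (simp add: mult_ac)
qed

lemma prod_dyadic_ratio: "(\<Prod>i<K. 2 ^ i / 2 ^ K :: real) = (1 / 2) ^ (K * (K + 1) div 2)"
proof -
  have "(\<Prod>i<k. 2 ^ i / 2 ^ K :: real) = 2 ^ (k * (k - 1) div 2) / 2 ^ (K * k)" for k
  proof (induction k)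
    case (Suc k)
    have "k * (k - 1) div 2 + k = Suc k * k div 2"
      by (induction k) auto
    then have "(2::real) ^ (Suc k * k div 2) = 2 ^ (k * (k - 1) div 2) * 2 ^ k"
      by (metis power_add)
    then show ?case
      using Suc by (simp add: power_add del: mult_Suc)
  qed simp
  moreover have "K * (K - 1) div 2 + K * (K + 1) div 2 = K * K"
  proof -
    have "2 * (K * (K - 1) div 2) = K * (K - 1)" "2 * (K * (K + 1) div 2) = K * (K + 1)"
      by (intro dvd_mult_div_cancel; cases K; simp del: mult_Suc mult_Suc_right)+
    then have "2 * (K * (K - 1) div 2 + K * (K + 1) div 2) = 2 * (K * K)"
      by (cases K) auto
    then show ?thesis by simp
  qed
  then have "(2::real) ^ (K * (K - 1) div 2) * 2 ^ (K * (K + 1) div 2) = 2 ^ (K * K)"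
    by (metis power_add)
  ultimately have "(\<Prod>i<K. 2 ^ i / 2 ^ K :: real) =
      2 ^ (K * (K - 1) div 2) / (2 ^ (K * (K - 1) div 2) * 2 ^ (K * (K + 1) div 2))"
    by presburger
  then show ?thesis by (simp add: power_one_over)
qed

text \<open>
  The decisive saving: differences of order \<open>K\<close>, which involve only numbers of size about
  \<open>K * 2 ^ K\<close>, reach a precision that is quadratic in \<open>K\<close> on the logarithmic scale.
\<close>

lemma log_diff_small:
  assumes "K \<ge> 1" "x \<ge> real K * 2 ^ K"
  shows "log_diff K x \<le> (1 / 2) ^ (K * (K + 1) div 2)"
  using log_diff_le_prod[OF assms(1) order_refl assms(2)] by (simp only: prod_dyadic_ratio)

text \<open>
  Consecutive orders overlap: order \<open>j + 1\<close>, used near its starting point \<open>2 * (j + 1)\<close>, still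
  reaches (up to a factor two) the values of order \<open>j\<close> far out. In the recursion at \<open>y\<close> at most
  \<open>7/9\<close> of \<open>log_diff j y\<close> is lost, since \<open>y \<le> 5/2 * 2 ^ j\<close>, whereas the passage from
  \<open>y\<close> to \<open>z\<close> loses at least \<open>5/9\<close> of it.
\<close>

lemma log_diff_Suc_ge:
  assumes j: "j \<ge> 1" and y: "real (2 * j + 2) \<le> y" "y \<le> real (2 * j + 3)"
    and z: "z \<ge> 8 * 2 ^ j"
  shows "log_diff j z \<le> 2 * log_diff (Suc j) y"
proof -
  have "4 * j + 6 \<le> 5 * 2 ^ j" if "j \<ge> 1" for j :: nat
    using that by (induction j rule: dec_induct) auto
  from this[OF j] have "real (4 * j + 6) \<le> real (5 * 2 ^ j)"
    by (rule of_nat_mono)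
  then have yS: "2 * y \<le> 5 * 2 ^ j" using y by simp
  have y0: "y > 0" using y by simp
  have pow: "(r::real) ^ j \<le> r" if "0 \<le> r" "r \<le> 1" for r
    using power_decreasing[of 1 j r] that j by simp
  have pos: "log_diff j y > 0" using log_diff_pos j y0 by simp
  have "((y + 2 ^ j) / (y + 2 ^ j + 2 ^ j)) ^ j \<le> (y + 2 ^ j) / (y + 2 ^ j + 2 ^ j)"
    using y0 by (intro pow) (auto simp: divide_simps add_pos_pos)
  also have "\<dots> \<le> 7 / 9"
    using y0 yS by (simp add: divide_simps add_pos_pos)
  finally have "((y + 2 ^ j) / (y + 2 ^ j + 2 ^ j)) ^ j * log_diff j y \<le> 7 / 9 * log_diff j y"
    using pos by (intro mult_right_mono) auto
  then have 1: "log_diff (Suc j) y \<ge> 2 / 9 * log_diff j y"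
    using log_diff_shift_le[of j y "2 ^ j"] j y0 by (simp add: log_diff_Suc)
  have "(2::real) ^ j > 0" by simp
  then have zy: "z \<ge> y" using z yS by linarith
  have z0: "z > 0" using y0 zy by linarith
  have "((y + 2 ^ j) / (z + 2 ^ j)) ^ j \<le> (y + 2 ^ j) / (z + 2 ^ j)"
    using y0 zy by (intro pow) (auto simp: divide_simps add_pos_pos)
  also have "\<dots> \<le> 4 / 9"
    using z0 yS z by (simp add: divide_simps add_pos_pos)
  finally have "((y + 2 ^ j) / (z + 2 ^ j)) ^ j * log_diff j y \<le> 4 / 9 * log_diff j y"
    using pos by (intro mult_right_mono) auto
  then have 2: "log_diff j z \<le> 4 / 9 * log_diff j y"
    using log_diff_shift_le[of j y "z - y"] j y0 zy by (simp add: add_ac)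
  show ?thesis using 1 2 by linarith
qed

text \<open>
  Discrete continuity. Take the least order \<open>k\<close> whose value at the far end \<open>Z\<close> of the range is at
  most \<open>v\<close>. At \<open>2 * k\<close>, the near end, the value is at least \<open>v / 2\<close>, by the overlap of
  consecutive orders. From \<open>2 * k\<close> on, a unit step at most halves the value, so the first
  \<open>z\<close> with value at most \<open>v\<close> works. The shift \<open>c\<close> makes room for the residue classes below.
\<close>

lemma log_diff_hits:
  assumes K: "K \<ge> 1" and c: "0 \<le> c" "c \<le> 1"
    and v: "(1 / 2) ^ (K * (K + 1) div 2) \<le> v" "v \<le> 1 / 2"
  shows "\<exists>k z. 1 \<le> k \<and> k \<le> K \<and> 2 \<le> z \<and> z \<le> K * 2 ^ (K + 3) \<and>
           v / 2 \<le> log_diff k (real z + c) \<and> log_diff k (real z + c) \<le> v"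
proof -
  define Z where "Z = K * 2 ^ (K + 3)"
  define k where "k = (LEAST k. 1 \<le> k \<and> log_diff k (real Z + c) \<le> v)"
  have ZK: "real Z + c \<ge> real K * 2 ^ K"
    using c by (simp add: Z_def power_add add_increasing2)
  have PK: "1 \<le> K \<and> log_diff K (real Z + c) \<le> v"
    using log_diff_small[OF K ZK] K v by auto
  have k: "1 \<le> k \<and> log_diff k (real Z + c) \<le> v"
    unfolding k_def by (rule LeastI, rule PK)
  have kK: "k \<le> K"
    unfolding k_def by (rule Least_le, rule PK)
  have start: "v / 2 \<le> log_diff k (real (2 * k) + c)"
  proof (cases "k = 1")
    case True
    have "ln (3 + c) - ln (2 + c) = - ln ((2 + c) / (3 + c))"
      using c by (simp add: ln_div)
    moreover have "ln ((2 + c) / (3 + c)) \<le> (2 + c) / (3 + c) - 1"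
      using c by (intro ln_le_minus_one) auto
    moreover have "(2 + c) / (3 + c) - 1 \<le> - (1 / 4)"
      using c by (simp add: divide_simps)
    ultimately show ?thesis
      using True v by (simp add: log_diff_1 add_ac)
  next
    case False
    then obtain j where j: "k = Suc j" "j \<ge> 1" using k by (cases k) auto
    have "j < k" using j by simp
    then have "\<not> (1 \<le> j \<and> log_diff j (real Z + c) \<le> v)"
      unfolding k_def by (rule not_less_Least)
    then have "v < log_diff j (real Z + c)" using j by simp
    also have "\<dots> \<le> 2 * log_diff (Suc j) (real (2 * k) + c)"
    proof (rule log_diff_Suc_ge)
      have "(2::real) ^ j \<le> 2 ^ K" using j kK by simp
      also have "\<dots> \<le> real K * 2 ^ K" using K by simp
      finally show "real Z + c \<ge> 8 * 2 ^ j" using c by (simp add: Z_def power_add)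
    qed (use j c in auto)
    finally show ?thesis using j by simp
  qed
  have "2 * k \<le> Z"
  proof -
    have "2 * k \<le> K * 2" using kK by simp
    also have "\<dots> \<le> K * 2 ^ (K + 3)" 
      by (intro mult_le_mono2) (simp add: power_add)
    finally show ?thesis by (simp add: Z_def)
  qed
  define z where "z = (LEAST z. 2 * k \<le> z \<and> log_diff k (real z + c) \<le> v)"
  have PZ: "2 * k \<le> Z \<and> log_diff k (real Z + c) \<le> v"
    using k \<open>2 * k \<le> Z\<close> by simp
  have z: "2 * k \<le> z \<and> log_diff k (real z + c) \<le> v"
    unfolding z_def by (rule LeastI, rule PZ)
  have zZ: "z \<le> Z"
    unfolding z_def by (rule Least_le, rule PZ)
  have "v / 2 \<le> log_diff k (real z + c)"
  proof (cases "z = 2 * k")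
    case True
    then show ?thesis using start by simp
  next
    case False
    then obtain y where y: "z = Suc y" "2 * k \<le> y" using z by (cases z) auto
    have "y < z" using y by simp
    then have "\<not> (2 * k \<le> y \<and> log_diff k (real y + c) \<le> v)"
      unfolding z_def by (rule not_less_Least)
    then have big: "v < log_diff k (real y + c)" using y by simp
    have "real k * 1 / (real y + c + 1) \<le> 1 / 2"
      using y c by (simp add: divide_simps)
    then have "(1 / 2) * log_diff k (real y + c)
        \<le> (1 - real k * 1 / (real y + c + 1)) * log_diff k (real y + c)"
      using log_diff_pos[of k "real y + c"] k y c by (intro mult_right_mono) auto
    also have "\<dots> \<le> log_diff k (real y + c + 1)"
      using k y c by (intro log_diff_shift_ge_Bernoulli) auto
    finally show ?thesis using big y by (simp add: add_ac)
  qed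
  then show ?thesis
    using k kK z zZ unfolding Z_def by (intro exI[of _ k] exI[of _ z]) auto
qed

section \<open>Realising the differences by products of integers\<close>

text \<open>
  The positions \<open>s < 2 ^ k\<close> with an even number (for \<open>b = False\<close>) or an odd number (for
  \<open>b = True\<close>) of binary digits one.
\<close>

primrec thue_morse :: "bool \<Rightarrow> nat \<Rightarrow> nat set" where
  "thue_morse b 0 = (if b then {} else {0})"
| "thue_morse b (Suc k) = thue_morse b k \<union> (\<lambda>s. s + 2 ^ k) ` thue_morse (\<not> b) k"

lemma thue_morse_subset: "thue_morse b k \<subseteq> {..<2 ^ k}"
proof (induction k arbitrary: b)
  case (Suc k)
  from Suc[of b] Suc[of "\<not> b"] show ?case by fastforce
qed auto

lemma finite_thue_morse [simp]: "finite (thue_morse b k)"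
  using thue_morse_subset by (rule finite_subset) simp

lemma thue_morse_disjoint: "thue_morse b k \<inter> thue_morse (\<not> b) k = {}"
proof (induction k arbitrary: b)
  case (Suc k)
  have "thue_morse b k \<inter> (\<lambda>s. s + 2 ^ k) ` thue_morse b' k = {}" for b b'
    using thue_morse_subset[of b k] by fastforce
  moreover have "(\<lambda>s. s + 2 ^ k) ` thue_morse b k \<inter> (\<lambda>s. s + 2 ^ k) ` thue_morse (\<not> b) k = {}" for b
    using Suc[of b] by fastforce
  ultimately show ?case
    using Suc[of b] by (simp add: Int_Un_distrib Int_Un_distrib2) (metis Int_commute)
qed auto

lemma dyadic_diff_eq_sum:
  "dyadic_diff k f x =
     (\<Sum>s\<in>thue_morse False k. f (x + real s)) - (\<Sum>s\<in>thue_morse True k. f (x + real s))"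
proof (induction k arbitrary: x)
  case (Suc k)
  have *: "(\<Sum>s\<in>thue_morse b (Suc k). f (x + real s)) =
      (\<Sum>s\<in>thue_morse b k. f (x + real s)) +
      (\<Sum>s\<in>thue_morse (\<not> b) k. f (x + 2 ^ k + real s))" for b
  proof -
    have "thue_morse b k \<inter> (\<lambda>s. s + 2 ^ k) ` thue_morse (\<not> b) k = {}"
      using thue_morse_subset[of b k] by fastforce
    then show ?thesis
      by (simp add: sum.union_disjoint sum.reindex inj_on_def add_ac)
  qed
  show ?case
    by (simp only: * dyadic_diff.simps Suc) (simp add: algebra_simps)
qed simp

abbreviation ln_sum :: "nat set \<Rightarrow> real" where
  "ln_sum A \<equiv> (\<Sum>a\<in>A. ln (real a))"

text \<open>
  Points spaced by one on the real line correspond to integers spaced by \<open>W\<close>, in one residue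
  class: the dilation by \<open>W\<close> cancels because both Thue--Morse classes have the same size.
\<close>

lemma ln_sum_gadget:
  fixes k W z r :: nat
  assumes k: "k \<ge> 1" and W: "W > 0" and x: "z > 0"
  defines "B \<equiv> \<lambda>b. (\<lambda>s. W * (z + s) + r) ` thue_morse b k"
  shows "ln_sum (B True) - ln_sum (B False) = log_diff k (real z + real r / real W)"
proof -
  let ?x = "real z + real r / real W"
  have "ln_sum (B b) = (\<Sum>s\<in>thue_morse b k. ln (real W)) + (\<Sum>s\<in>thue_morse b k. ln (?x + real s))" for b
  proof -
    have "real (W * (z + s) + r) = real W * (?x + real s)" for s
      using W by (simp add: field_simps)
    moreover have "?x + real s > 0" for s
      using x by (simp add: add_pos_nonneg)
    ultimately have "ln (real (W * (z + s) + r)) = ln (real W) + ln (?x + real s)" for s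
      using W by (simp add: ln_mult_pos del: of_nat_add of_nat_mult)
    moreover have "inj_on (\<lambda>s. W * (z + s) + r) (thue_morse b k)"
      using W by (auto simp: inj_on_def)
    ultimately show ?thesis
      unfolding B_def by (simp add: sum.reindex sum.distrib del: of_nat_add of_nat_mult sum_constant)
  qed
  moreover have "(\<Sum>s\<in>thue_morse True k. ln (real W)) = (\<Sum>s\<in>thue_morse False k. ln (real W))"
    using dyadic_diff_const[OF k, of "ln (real W)" 0] unfolding dyadic_diff_eq_sum by linarith
  ultimately show ?thesis
    by (simp add: log_diff_def dyadic_diff_eq_sum sum_negf)
qed

text \<open>
  Among the factors of a product of distinct integers, replacing the block \<open>Q\<close> by \<open>P\<close> multiplies
  the product by a factor whose logarithm is prescribed up to a factor two. All integers involved
  lie in the residue class of \<open>r\<close>, so blocks for different \<open>r\<close> cannot collide, and they are at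
  least \<open>2 * W\<close>, so the smaller integers stay free.
\<close>

lemma gadget_exists:
  assumes K: "K \<ge> 1" and r: "r < W"
    and n: "W * (K * 2 ^ (K + 3) + 2 ^ K) \<le> n"
    and v: "(1 / 2) ^ (K * (K + 1) div 2) \<le> v" "v \<le> 1 / 2"
  shows "\<exists>P Q. P \<union> Q \<subseteq> {a. 2 * W \<le> a \<and> a \<le> n \<and> a mod W = r} \<and> P \<inter> Q = {} \<and>
           card (P \<union> Q) \<le> 2 ^ K \<and> v / 2 \<le> ln_sum P - ln_sum Q \<and> ln_sum P - ln_sum Q \<le> v"
proof -
  from r have W: "W > 0" by simp
  have "0 \<le> real r / real W" "real r / real W \<le> 1" using r by auto
  from log_diff_hits[OF K this v] obtain k z where kz: "1 \<le> k" "k \<le> K" "2 \<le> z" "z \<le> K * 2 ^ (K + 3)"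
    "v / 2 \<le> log_diff k (real z + real r / real W)" "log_diff k (real z + real r / real W) \<le> v"
    by blast
  define e where "e = (\<lambda>s. W * (z + s) + r)"
  define P where "P = e ` thue_morse True k"
  define Q where "Q = e ` thue_morse False k"
  have PQ: "P \<union> Q \<subseteq> e ` {..<2 ^ k}"
    using thue_morse_subset unfolding P_def Q_def by blast
  have kK: "(2::nat) ^ k \<le> 2 ^ K" using kz by simp
  have "e ` {..<2 ^ k} \<subseteq> {a. 2 * W \<le> a \<and> a \<le> n \<and> a mod W = r}"
  proof safe
    fix s :: nat assume s: "s < 2 ^ k"
    have "W * 2 \<le> W * (z + s)" using kz by (intro mult_le_mono2) simp
    then show "2 * W \<le> e s" unfolding e_def by linarith
    have "e s \<le> W * (z + s + 1)" using r by (simp add: e_def)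
    also have "\<dots> \<le> W * (K * 2 ^ (K + 3) + 2 ^ K)"
      using kz s kK by (intro mult_le_mono2) linarith
    finally show "e s \<le> n" using n by simp
    show "e s mod W = r" using r by (simp add: e_def)
  qed
  with PQ have "P \<union> Q \<subseteq> {a. 2 * W \<le> a \<and> a \<le> n \<and> a mod W = r}" by blast
  moreover have "P \<inter> Q = {}"
  proof -
    have "inj e" using W by (auto simp: e_def inj_def)
    then show ?thesis
      unfolding P_def Q_def using thue_morse_disjoint[of True k] by (simp flip: image_Int)
  qed
  moreover have "card (P \<union> Q) \<le> 2 ^ K"
  proof -
    have "card (P \<union> Q) \<le> card (e ` {..<2 ^ k})"
      using PQ by (intro card_mono) auto
    also have "\<dots> \<le> 2 ^ k" using card_image_le[of "{..<2 ^ k}" e] by simp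
    finally show ?thesis using kK by linarith
  qed
  moreover have "ln_sum P - ln_sum Q = log_diff k (real z + real r / real W)"
    unfolding P_def Q_def e_def using kz by (intro ln_sum_gadget) (auto simp: W)
  ultimately show ?thesis using kz by (intro exI[of _ P] exI[of _ Q]) simp
qed

section \<open>Approximation by greedy subset sums\<close>

definition fills :: "('a \<Rightarrow> real) \<Rightarrow> 'a set \<Rightarrow> real \<Rightarrow> real \<Rightarrow> bool" where
  "fills w S \<epsilon> \<tau> \<longleftrightarrow> (\<forall>t. 0 \<le> t \<and> t \<le> \<tau> \<longrightarrow> (\<exists>I\<subseteq>S. 0 \<le> t - sum w I \<and> t - sum w I \<le> \<epsilon>))"

lemma fills_empty: "fills w {} \<epsilon> \<epsilon>"
  by (auto simp: fills_def)

lemma fills_mono: "fills w S \<epsilon> \<tau> \<Longrightarrow> \<tau>' \<le> \<tau> \<Longrightarrow> fills w S \<epsilon> \<tau>'"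
  by (auto simp: fills_def)

text \<open>
  The greedy step: an item that fits into the target is used. As its weight is at most \<open>\<tau>\<close>, the
  remaining target is in the old range in both cases.
\<close>

lemma fills_insert:
  assumes "fills w S \<epsilon> \<tau>" "finite S" "x \<notin> S" "w x \<le> \<tau>"
  shows "fills w (insert x S) \<epsilon> (\<tau> + w x)"
  unfolding fills_def
proof (intro allI impI)
  fix t assume t: "0 \<le> t \<and> t \<le> \<tau> + w x"
  show "\<exists>I\<subseteq>insert x S. 0 \<le> t - sum w I \<and> t - sum w I \<le> \<epsilon>"
  proof (cases "t < w x")
    case True
    then have "0 \<le> t \<and> t \<le> \<tau>" using t assms by simp
    then obtain I where "I \<subseteq> S" "0 \<le> t - sum w I" "t - sum w I \<le> \<epsilon>"
      using assms(1) unfolding fills_def by blast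
    then show ?thesis by (intro exI[of _ I]) auto
  next
    case False
    then have "0 \<le> t - w x \<and> t - w x \<le> \<tau>" using t by simp
    then obtain I where I: "I \<subseteq> S" "0 \<le> t - w x - sum w I" "t - w x - sum w I \<le> \<epsilon>"
      using assms(1) unfolding fills_def by blast
    have "sum w (insert x I) = w x + sum w I"
      using I(1) assms by (subst sum.insert) (auto intro: finite_subset)
    then show ?thesis using I by (intro exI[of _ "insert x I"]) auto
  qed
qed

text \<open>
  Two weights per dyadic scale suffice: those of scale \<open>q\<close> add up to at least \<open>(1 / 2) ^ (q + 1)\<close>,
  which doubles the range obtained from the finer scales.
\<close>

lemma fills_dyadic:
  assumes "\<And>i. i < 2 * A \<Longrightarrow> (1 / 2) ^ (i div 2 + 2) \<le> \<rho> i \<and> \<rho> i \<le> (1 / 2) ^ (i div 2 + 1)"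
  shows "fills \<rho> {..<2 * A} ((1 / 2) ^ A) 1"
proof -
  have "fills \<rho> {2 * q..<2 * A} ((1 / 2) ^ A) ((1 / 2) ^ q)" if "q \<le> A" for q
    using that
  proof (induction q rule: inc_induct)
    case base
    then show ?case by (simp add: fills_empty)
  next
    case (step q)
    have r: "(1 / 2) ^ (q + 2) \<le> \<rho> i \<and> \<rho> i \<le> (1 / 2) ^ (q + 1)" if "i = 2 * q \<or> i = Suc (2 * q)" for i
      using assms[of i] that step by auto
    have pos: "\<rho> (Suc (2 * q)) \<ge> 0"
    proof -
      have "0 \<le> (1 / 2 :: real) ^ (q + 2)" by simp
      with r[of "Suc (2 * q)"] show ?thesis by linarith
    qed
    have "fills \<rho> (insert (Suc (2 * q)) {2 * Suc q..<2 * A}) ((1 / 2) ^ A)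
        ((1 / 2) ^ Suc q + \<rho> (Suc (2 * q)))"
    proof (rule fills_insert)
      show "fills \<rho> {2 * Suc q..<2 * A} ((1 / 2) ^ A) ((1 / 2) ^ Suc q)" by (rule step.IH)
      show "\<rho> (Suc (2 * q)) \<le> (1 / 2) ^ Suc q" using r[of "Suc (2 * q)"] by simp
    qed auto
    then have F: "fills \<rho> (insert (2 * q) (insert (Suc (2 * q)) {2 * Suc q..<2 * A})) ((1 / 2) ^ A)
        ((1 / 2) ^ Suc q + \<rho> (Suc (2 * q)) + \<rho> (2 * q))"
    proof (rule fills_insert)
      show "\<rho> (2 * q) \<le> (1 / 2) ^ Suc q + \<rho> (Suc (2 * q))"
        using r[of "2 * q"] pos by simp
    qed auto
    have E: "insert (2 * q) (insert (Suc (2 * q)) {2 * Suc q..<2 * A}) = {2 * q..<2 * A}"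
      using step by auto
    have "(1 / 2) ^ q \<le> (1 / 2) ^ Suc q + \<rho> (Suc (2 * q)) + \<rho> (2 * q)"
      using r[of "2 * q"] r[of "Suc (2 * q)"] by simp
    then show ?case by (rule fills_mono[OF F[unfolded E]])
  qed
  from this[of 0] show ?thesis by (simp add: lessThan_atLeast0)
qed

text \<open>
  Subset products of integers approximate within a factor two. The integers \<open>2, 3, \<dots>, M\<close> are
  inserted in this order, each being at most twice the product of its predecessors. After that
  the range \<open>2 * fact M\<close> exceeds every other integer in \<open>C\<close>, and their order is irrelevant.
\<close>

lemma fills_coarse:
  assumes C: "{2..M} \<subseteq> C" "C \<subseteq> {2..n}" and n: "real n \<le> 2 * fact M"
  shows "fills (\<lambda>a. ln (real a)) C (ln 2) (ln 2 + ln_sum C)"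
proof -
  have small: "fills (\<lambda>a. ln (real a)) {2..m} (ln 2) (ln 2 + ln_sum {2..m}) \<and>
      ln_sum {2..m} = ln (fact m)" for m
  proof (induction m)
    case (Suc m)
    show ?case
    proof (cases "m = 0")
      case False
      have ins: "{2..Suc m} = insert (Suc m) {2..m}"
        using False by auto
      have "real (Suc m) \<le> 2 * fact m"
      proof -
        have "real m \<le> fact m"
          using fact_ge_self[of m] of_nat_le_iff[where 'a=real] by (metis of_nat_fact)
        then show ?thesis using False by simp
      qed
      then have "ln (real (Suc m)) \<le> ln (2 * fact m)" by (subst ln_le_cancel_iff) auto
      then have "ln (real (Suc m)) \<le> ln 2 + ln_sum {2..m}" using Suc by (simp add: ln_mult_pos)
      then have "fills (\<lambda>a. ln (real a)) (insert (Suc m) {2..m}) (ln 2)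
          (ln 2 + ln_sum {2..m} + ln (real (Suc m)))"
        using Suc by (intro fills_insert) auto
      moreover have "ln_sum {2..Suc m} = ln_sum {2..m} + ln (real (Suc m))"
        by (subst ins) simp
      moreover have "ln (fact (Suc m)) = ln (fact m) + ln (real (Suc m))"
        by (simp add: ln_mult_pos del: of_nat_Suc)
      ultimately show ?thesis using Suc ins by (simp add: add_ac)
    qed (auto simp: fills_empty)
  qed (auto simp: fills_empty)
  have "fills (\<lambda>a. ln (real a)) ({2..M} \<union> R) (ln 2) (ln 2 + ln_sum ({2..M} \<union> R))"
    if "finite R" "R \<subseteq> C - {2..M}" for R
    using that
  proof (induction R rule: finite_induct)
    case empty
    then show ?case using small[of M] by auto
  next
    case (insert x R)
    have x: "x \<ge> 2" "x \<le> n" "x \<notin> {2..M} \<union> R" using insert C by auto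
    have "ln (real x) \<le> ln (2 * fact M)"
      using x n by (subst ln_le_cancel_iff) auto
    also have "\<dots> = ln 2 + ln_sum {2..M}" using small[of M] by (simp add: ln_mult_pos)
    also have "ln_sum {2..M} \<le> ln_sum ({2..M} \<union> R)"
      using insert C by (intro sum_mono2) auto
    finally have "fills (\<lambda>a. ln (real a)) (insert x ({2..M} \<union> R)) (ln 2)
        (ln 2 + ln_sum ({2..M} \<union> R) + ln (real x))"
      using insert x by (intro fills_insert) auto
    then show ?case using x insert by (simp add: add_ac)
  qed
  from this[of "C - {2..M}"] show ?thesis
    using C finite_subset[OF C(2)] by (simp add: Un_absorb1)
qed

section \<open>Divisors of factorials are dense\<close>

lemma ln_sum_prod: "finite A \<Longrightarrow> 0 \<notin> A \<Longrightarrow> ln (real (\<Prod>A)) = ln_sum A"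
  by (subst of_nat_prod, subst ln_prod) (auto intro!: Nat.gr0I)

lemma ln_fact_eq: "ln (fact n) = ln_sum {1..n}"
  by (subst ln_sum_prod[symmetric]) (auto simp: fact_prod)

text \<open>
  A product of distinct integers from \<open>{1..n}\<close> divides \<open>fact n\<close>. For each residue \<open>i\<close> modulo
  \<open>W\<close> there is a pair of blocks \<open>P i\<close>, \<open>Q i\<close>, two pairs for each dyadic scale down to
  \<open>(1 / 2) ^ (W div 2)\<close>. The product contains all \<open>Q i\<close> as a base, a subset \<open>U\<close> of the integers
  outside the blocks brings it within a factor two of the target, and replacing \<open>Q i\<close> by \<open>P i\<close> for
  \<open>i\<close> in a suitable set \<open>I\<close> does the fine adjustment. At most \<open>W * 2 ^ K\<close> integers lie in
  blocks. This explains the two margins at the ends of the range of \<open>x\<close>.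
\<close>

lemma divisor_of_fact_near:
  assumes K: "K \<ge> 1" and W: "W = K * (K + 1)"
    and n: "W * (K * 2 ^ (K + 3) + 2 ^ K) \<le> n" and nW: "real n \<le> 2 * fact (2 * W - 1)"
    and x: "real W * 2 ^ K * ln (real n) \<le> x" "x \<le> ln (fact n) - real W * 2 ^ K * ln (real n)"
  shows "\<exists>d. d dvd fact n \<and> ln (real d) \<le> x \<and> x \<le> ln (real d) + (1 / 2) ^ (W div 2)"
proof -
  define A where "A = W div 2"
  have WA: "W = 2 * A" unfolding A_def W by (simp add: even_mult_iff)
  define gadget where "gadget = (\<lambda>i P Q.
      P \<union> Q \<subseteq> {a. 2 * W \<le> a \<and> a \<le> n \<and> a mod W = i} \<and> P \<inter> Q = {} \<and>
      card (P \<union> Q) \<le> 2 ^ K \<and> (1 / 2) ^ (i div 2 + 1) / 2 \<le> ln_sum P - ln_sum Q \<and>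
      ln_sum P - ln_sum Q \<le> (1 / 2) ^ (i div 2 + 1))"
  have "\<exists>P Q. gadget i P Q" if "i < W" for i
    unfolding gadget_def
  proof (rule gadget_exists[OF K that n])
    have "i div 2 + 1 \<le> A" using that WA by auto
    then show "(1 / 2) ^ (K * (K + 1) div 2) \<le> (1 / 2 :: real) ^ (i div 2 + 1)"
      unfolding A_def W by (intro power_decreasing) auto
    show "(1 / 2 :: real) ^ (i div 2 + 1) \<le> 1 / 2"
      using power_le_one[of "1 / 2 :: real" "i div 2"] by simp
  qed
  then obtain P Q where "gadget i (P i) (Q i)" if "i < W" for i
    by metis
  then have PQ: "P i \<union> Q i \<subseteq> {a. 2 * W \<le> a \<and> a \<le> n \<and> a mod W = i}" "P i \<inter> Q i = {}"
      "card (P i \<union> Q i) \<le> 2 ^ K" "(1 / 2) ^ (i div 2 + 2) \<le> ln_sum (P i) - ln_sum (Q i)"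
      "ln_sum (P i) - ln_sum (Q i) \<le> (1 / 2) ^ (i div 2 + 1)" if "i < W" for i
    using that unfolding gadget_def by simp_all
  define G where "G = (\<Union>i<W. P i \<union> Q i)"
  define C where "C = {2..n} - G"
  have W2: "W \<ge> 2" using K unfolding W by (cases K) auto
  have G: "G \<subseteq> {2 * W..n}" using PQ(1) unfolding G_def by fastforce
  have finG: "finite G" using G by (rule finite_subset) simp
  have fin: "finite (P i)" "finite (Q i)" if "i < W" for i
    using finG that unfolding G_def by (auto intro: finite_subset)
  have n1: "n \<ge> 1" using n W2 by (cases n) auto
  have disj: "(P i \<union> Q i) \<inter> (P j \<union> Q j) = {}" if "i < W" "j < W" "i \<noteq> j" for i j
    using PQ(1)[OF that(1)] PQ(1)[OF that(2)] that(3) by blast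
  have LG: "ln_sum G \<le> real W * 2 ^ K * ln (real n)"
  proof -
    have "card G \<le> (\<Sum>i<W. card (P i \<union> Q i))"
      unfolding G_def by (rule card_UN_le) simp
    also have "\<dots> \<le> (\<Sum>i<W. 2 ^ K)"
      using PQ(3) by (intro sum_mono) auto
    finally have "card G \<le> W * 2 ^ K" by simp
    then have "real (card G) \<le> real (W * 2 ^ K)" by (rule of_nat_mono)
    then have c: "real (card G) \<le> real W * 2 ^ K" by simp
    have "ln_sum G \<le> (\<Sum>a\<in>G. ln (real n))"
      using G W2 n1 by (intro sum_mono) (auto simp: subset_iff)
    also have "\<dots> \<le> real W * 2 ^ K * ln (real n)"
      using c n1 by (simp add: mult_right_mono)
    finally show ?thesis .
  qed
  have LC: "ln_sum C + ln_sum G = ln (fact n)"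
  proof -
    have "{1..n} = insert 1 (C \<union> G)" using n1 G W2 unfolding C_def by auto
    moreover have "1 \<notin> C \<union> G" using G W2 unfolding C_def by auto
    moreover have "C \<inter> G = {}" "finite C" unfolding C_def by auto
    ultimately show ?thesis
      using finG by (simp add: ln_fact_eq sum.union_disjoint)
  qed
  \<comment> \<open>what remains for the coarse factors and the exchanges once all blocks \<open>Q i\<close> are in the product\<close>
  define y where "y = x - (\<Sum>i<W. ln_sum (Q i))"
  have LQ: "(\<Sum>i<W. ln_sum (Q i)) = ln_sum (\<Union>i<W. Q i)"
  proof (rule sum.UNION_disjoint[symmetric])
    show "\<forall>i\<in>{..<W}. \<forall>j\<in>{..<W}. i \<noteq> j \<longrightarrow> Q i \<inter> Q j = {}"
      using disj by blast
  qed (use fin in auto)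
  also have "\<dots> \<le> ln_sum G"
    using finG G W2 unfolding G_def by (intro sum_mono2) (fastforce simp: subset_iff)+
  finally have "0 \<le> y" using LG x unfolding y_def by linarith
  have "0 \<le> ln_sum (\<Union>i<W. Q i)"
    using G W2 unfolding G_def by (intro sum_nonneg) (fastforce simp: subset_iff)
  then have "y \<le> ln 2 + ln_sum C"
    using LQ LC LG x ln_ge_zero[of 2] unfolding y_def by linarith
  have "2 * W \<le> n"
  proof -
    have "2 ^ 1 \<le> (2::nat) ^ (K + 3)" by (intro power_increasing) auto
    also have "\<dots> \<le> K * 2 ^ (K + 3) + 2 ^ K" using K by (cases K) auto
    finally have "W * 2 \<le> W * (K * 2 ^ (K + 3) + 2 ^ K)" by (intro mult_le_mono2) simp
    then show ?thesis using n by linarith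
  qed
  then have "{2..2 * W - 1} \<subseteq> C" unfolding C_def using G by fastforce
  then have "fills (\<lambda>a. ln (real a)) C (ln 2) (ln 2 + ln_sum C)"
    by (rule fills_coarse[OF _ _ nW]) (auto simp: C_def)
  then obtain U where U: "U \<subseteq> C" "0 \<le> y - ln_sum U" "y - ln_sum U \<le> ln 2"
    using \<open>0 \<le> y\<close> \<open>y \<le> ln 2 + ln_sum C\<close> unfolding fills_def by blast
  define \<rho> where "\<rho> = (\<lambda>i. ln_sum (P i) - ln_sum (Q i))"
  have "fills \<rho> {..<2 * A} ((1 / 2) ^ A) 1"
    by (rule fills_dyadic) (use PQ(4,5) in \<open>auto simp: \<rho>_def WA\<close>)
  moreover have "y - ln_sum U \<le> 1" using U(3) ln_2_less_1 by linarith
  ultimately obtain I where I: "I \<subseteq> {..<W}"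
      "0 \<le> y - ln_sum U - sum \<rho> I" "y - ln_sum U - sum \<rho> I \<le> (1 / 2) ^ A"
    using U(2) unfolding fills_def WA by blast
  define R where "R = (\<lambda>i. if i \<in> I then P i else Q i)"
  define V where "V = U \<union> (\<Union>i<W. R i)"
  have R: "R i \<subseteq> P i \<union> Q i" for i by (auto simp: R_def)
  have RG: "(\<Union>i<W. R i) \<subseteq> G" using R unfolding G_def by blast
  have "ln_sum V = ln_sum U + ln_sum (\<Union>i<W. R i)"
    unfolding V_def using U(1) RG finG
    by (intro sum.union_disjoint) (auto simp: C_def intro: finite_subset)
  also have "ln_sum (\<Union>i<W. R i) = (\<Sum>i<W. ln_sum (R i))"
  proof (rule sum.UNION_disjoint)
    show "\<forall>i\<in>{..<W}. finite (R i)" using fin by (auto simp: R_def)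
    show "\<forall>i\<in>{..<W}. \<forall>j\<in>{..<W}. i \<noteq> j \<longrightarrow> R i \<inter> R j = {}"
      using disj R by blast
  qed simp
  also have "\<dots> = (\<Sum>i<W. ln_sum (Q i) + (if i \<in> I then \<rho> i else 0))"
    by (intro sum.cong) (auto simp: R_def \<rho>_def)
  also have "\<dots> = (\<Sum>i<W. ln_sum (Q i)) + sum \<rho> I"
    using I(1) by (simp add: sum.distrib sum.If_cases Int_absorb1)
  finally have LV: "ln_sum V = x - (y - ln_sum U - sum \<rho> I)"
    by (simp add: y_def)
  have V: "V \<subseteq> {1..n}"
    using U(1) RG G W2 unfolding V_def C_def by fastforce
  then have finV: "finite V" by (rule finite_subset) simp
  have "\<Prod>V dvd \<Prod>{1..n}"
    using V by (intro prod_dvd_prod_subset) auto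
  then have "\<Prod>V dvd fact n" by (simp add: fact_prod)
  moreover have "ln (real (\<Prod>V)) = ln_sum V"
    using V finV by (intro ln_sum_prod) auto
  ultimately show ?thesis
    using LV I(2,3) unfolding A_def by (intro exI[of _ "\<Prod>V"]) auto
qed

section \<open>Writing integers as sums of few divisors\<close>

lemma binary_digits:
  fixes q :: nat
  assumes "q < 2 ^ j"
  shows "\<exists>B\<subseteq>{..<j}. q = (\<Sum>b\<in>B. 2 ^ b)"
  using assms
proof (induction j arbitrary: q)
  case (Suc j)
  show ?case
  proof (cases "q < 2 ^ j")
    case True
    from Suc.IH[OF this] obtain B where "B \<subseteq> {..<j}" "q = (\<Sum>b\<in>B. 2 ^ b)" by blast
    then show ?thesis by (intro exI[of _ B]) auto
  next
    case False
    then have "q - 2 ^ j < 2 ^ j" using Suc.prems by simp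
    from Suc.IH[OF this] obtain B where B: "B \<subseteq> {..<j}" "q - 2 ^ j = (\<Sum>b\<in>B. 2 ^ b)" by blast
    have "(\<Sum>b\<in>insert j B. 2 ^ b) = 2 ^ j + (\<Sum>b\<in>B. 2 ^ b :: nat)"
      using B(1) by (subst sum.insert) (auto intro: finite_subset)
    with B False show ?thesis by (intro exI[of _ "insert j B"]) auto
  qed
qed auto

text \<open>
  The property minimised over \<open>c\<close> in the definition of \<open>h N\<close>, for a single \<open>m\<close>. Here \<open>m = 0\<close> is
  allowed as the empty sum, which is the end of the recursions below.
\<close>

definition divisor_sum :: "nat \<Rightarrow> nat \<Rightarrow> nat \<Rightarrow> bool" where
  "divisor_sum N c m \<longleftrightarrow> (\<exists>D. D \<subseteq> {d. d dvd N} \<and> card D \<le> c \<and> \<Sum>D = m)"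

lemma divisor_sum_mono: "divisor_sum N c m \<Longrightarrow> c \<le> c' \<Longrightarrow> divisor_sum N c' m"
  unfolding divisor_sum_def by (elim exE conjE) (intro exI conjI, assumption, erule order_trans)

text \<open>
  Divisors larger than \<open>m\<close> cannot occur in a representation of \<open>m\<close>, so distinctness is automatic.
\<close>

lemma divisor_sum_add:
  assumes N: "N > 0" and D: "D \<subseteq> {d. d dvd N}" "\<And>d. d \<in> D \<Longrightarrow> m < d"
    and m: "divisor_sum N c m"
  shows "divisor_sum N (card D + c) (\<Sum>D + m)"
proof -
  obtain E where E: "E \<subseteq> {d. d dvd N}" "card E \<le> c" "\<Sum>E = m"
    using m unfolding divisor_sum_def by blast
  have fin: "finite D" "finite E"
    using D(1) E(1) N by (auto intro: finite_subset)
  have "e \<le> m" if "e \<in> E" for e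
    using member_le_sum[of e E "\<lambda>x. x"] that fin E(3) by simp
  then have "D \<inter> E = {}" using D(2) by fastforce
  then have "\<Sum>(D \<union> E) = \<Sum>D + m"
    using fin E(3) by (simp add: sum.union_disjoint)
  moreover have "card (D \<union> E) \<le> card D + c"
    using card_Un_le[of D E] E(2) by linarith
  ultimately show ?thesis
    unfolding divisor_sum_def using D(1) E(1) by (intro exI[of _ "D \<union> E"]) auto
qed

text \<open>
  The multiple \<open>q * M\<close> is written with the divisors \<open>M * 2 ^ b\<close>, one for each binary digit of
  \<open>q\<close>; they all exceed \<open>r\<close>. This is used at both ends of the scale, with \<open>M = 1\<close> and with
  \<open>M = N div 2 ^ J\<close>.
\<close>

lemma divisor_sum_binary:
  assumes N: "M * 2 ^ J dvd N" "N > 0" and q: "q < 2 ^ j" "j \<le> Suc J"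
    and r: "divisor_sum N c r" "r < M"
  shows "divisor_sum N (j + c) (q * M + r)"
proof -
  obtain B where B: "B \<subseteq> {..<j}" "q = (\<Sum>b\<in>B. 2 ^ b)" using binary_digits[OF q(1)] by blast
  define D where "D = (\<lambda>b. M * 2 ^ b) ` B"
  have M: "M > 0" using r by simp
  have "inj_on (\<lambda>b. M * 2 ^ b) B" using M by (auto simp: inj_on_def)
  then have sum: "\<Sum>D = q * M"
    unfolding D_def by (simp add: sum.reindex B(2) mult.commute flip: sum_distrib_left)
  have "card D \<le> card B" unfolding D_def using B(1) by (intro card_image_le) (auto intro: finite_subset)
  also have "\<dots> \<le> card {..<j}" using B(1) by (intro card_mono) auto
  finally have card: "card D \<le> j" by simp
  have "D \<subseteq> {d. d dvd N}"
  proof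
    fix d assume "d \<in> D"
    then obtain b where b: "b < j" "d = M * 2 ^ b" using B(1) unfolding D_def by auto
    then have "d dvd M * 2 ^ J" using q(2) by (simp add: le_imp_power_dvd)
    then show "d \<in> {d. d dvd N}" using N(1) dvd_trans by blast
  qed
  moreover have "r < d" if dD: "d \<in> D" for d
  proof -
    obtain b where "d = M * 2 ^ b" using dD unfolding D_def by auto
    then have "M \<le> d" by simp
    then show ?thesis using r by simp
  qed
  ultimately have "divisor_sum N (card D + c) (\<Sum>D + r)"
    using N(2) r(1) by (intro divisor_sum_add) auto
  then show ?thesis unfolding sum by (rule divisor_sum_mono) (use card in simp)
qed

lemma divisor_sum_0: "divisor_sum N 0 0"
  unfolding divisor_sum_def by (intro exI[of _ "{}"]) simp

text \<open>
  Each subtraction of a nearby divisor shrinks the remainder by the factor \<open>\<epsilon>\<close>, until it is below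
  \<open>2 ^ J\<close>, where binary digits finish. Since \<open>\<epsilon> < 1 / 2\<close>, the divisor is larger than what it
  leaves.
\<close>

lemma divisor_sum_greedy:
  assumes N: "N > 0" "2 ^ J dvd N" and e: "0 < \<epsilon>" "\<epsilon> < 1 / 2"
    and dense: "\<And>m. 2 ^ J \<le> m \<Longrightarrow> m * 2 ^ J \<le> N \<Longrightarrow>
      \<exists>d. d dvd N \<and> d \<le> m \<and> real (m - d) \<le> \<epsilon> * real m"
    and m: "m * 2 ^ J \<le> N" "real m * \<epsilon> ^ s < 2 ^ J"
  shows "divisor_sum N (s + J) m"
proof -
  have small: "divisor_sum N J m" if "m < 2 ^ J" for m
    using divisor_sum_binary[of 1 J N m J 0 0] N that divisor_sum_0 by simp
  show ?thesis
    using m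
  proof (induction s arbitrary: m)
    case 0
    then have "real m < real (2 ^ J)" by simp
    then show ?case using small by (simp only: of_nat_less_iff add_0)
  next
    case (Suc s)
    show ?case
    proof (cases "m < 2 ^ J")
      case True
      from small[OF this] show ?thesis by (rule divisor_sum_mono) simp
    next
      case False
      then obtain d where d: "d dvd N" "d \<le> m" "real (m - d) \<le> \<epsilon> * real m"
        using dense[of m] Suc.prems by auto
      have "m > 0" using False by (intro Nat.gr0I) auto
      then have "\<epsilon> * real m < 1 / 2 * real m" using e by (intro mult_strict_right_mono) auto
      then have "m - d < d" using d by (simp add: of_nat_diff)
      have "(m - d) * 2 ^ J \<le> m * 2 ^ J" by (intro mult_right_mono) auto
      then have "(m - d) * 2 ^ J \<le> N" using Suc.prems(1) by (rule order_trans)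
      moreover have "real (m - d) * \<epsilon> ^ s \<le> \<epsilon> * real m * \<epsilon> ^ s"
        using d e by (intro mult_right_mono) auto
      ultimately have "divisor_sum N (s + J) (m - d)"
        using Suc.prems by (intro Suc.IH) (auto simp: mult_ac)
      then have "divisor_sum N (card {d} + (s + J)) (\<Sum>{d} + (m - d))"
        using N(1) d(1) \<open>m - d < d\<close> by (intro divisor_sum_add) auto
      then show ?thesis using d(2) by simp
    qed
  qed
qed

text \<open>
  Reducing modulo \<open>M = N div 2 ^ J\<close> brings \<open>m\<close> into the range where dense divisors are available.
  The quotient is at most \<open>2 ^ J\<close>, with equality for \<open>m = N\<close>, hence \<open>J + 1\<close> binary digits.
\<close>

lemma h_le_of_dense_divisors:
  assumes N: "N > 0" "2 ^ J dvd N" and e: "0 < \<epsilon>" "\<epsilon> < 1 / 2"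
    and dense: "\<And>m. 2 ^ J \<le> m \<Longrightarrow> m * 2 ^ J \<le> N \<Longrightarrow>
      \<exists>d. d dvd N \<and> d \<le> m \<and> real (m - d) \<le> \<epsilon> * real m"
    and s: "real N * \<epsilon> ^ s < 2 ^ J"
  shows "h N \<le> 2 * J + 1 + s"
proof (rule h_le)
  fix m assume m: "1 \<le> m" "m \<le> N"
  define M where "M = N div 2 ^ J"
  have NM: "N = M * 2 ^ J" using N(2) unfolding M_def by simp
  then have M: "M > 0" using N(1) by (intro Nat.gr0I) auto
  have r: "m mod M < M" using M by simp
  have rN: "m mod M * 2 ^ J \<le> N" unfolding NM using r by (intro mult_right_mono) auto
  have "real (m mod M) * \<epsilon> ^ s \<le> real N * \<epsilon> ^ s"
    using m e by (intro mult_right_mono) (auto intro: order_trans[OF mod_less_eq_dividend])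
  then have "divisor_sum N (s + J) (m mod M)"
    using s rN by (intro divisor_sum_greedy[OF N e dense]) auto
  moreover have "m div M \<le> 2 ^ J"
    using div_le_mono[OF m(2), of M] M unfolding NM by simp
  then have "m div M < 2 ^ Suc J" by (rule le_less_trans) simp
  ultimately have "divisor_sum N (Suc J + (s + J)) (m div M * M + m mod M)"
    using N r NM by (intro divisor_sum_binary) auto
  then show "\<exists>D. D \<subseteq> {d. d dvd N} \<and> card D \<le> 2 * J + 1 + s \<and> \<Sum>D = m"
    by (simp add: divisor_sum_def mult_2 add_ac)
qed

section \<open>The bound for factorials\<close>

lemma two_power_dvd_fact: "2 ^ j dvd (fact (2 * j) :: nat)"
proof (induction j)
  case (Suc j)
  have "fact (2 * Suc j) = 2 * (fact (2 * j) * (Suc (2 * j) * Suc j) :: nat)"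
    by (simp add: algebra_simps)
  then show ?case using Suc by (simp del: fact_Suc mult_Suc) 
qed simp

lemma two_power_le_fact: "2 ^ m \<le> 2 * (fact m :: real)"
proof (induction m)
  case (Suc m)
  show ?case
  proof (cases "m = 0")
    case False
    have "2 ^ Suc m \<le> 2 * (2 * fact m :: real)" using Suc by simp
    also have "\<dots> \<le> real (Suc m) * (2 * fact m)" using False by (intro mult_right_mono) auto
    finally show ?thesis by (simp add: algebra_simps)
  qed simp
qed simp

text \<open>
  The parameters are chosen so that \<open>2 ^ J\<close> is at least the product of all integers in blocks, which
  makes \<open>J\<close> a sufficient margin at both ends, and so that \<open>l * n div (W div 2) + 1\<close> steps reduce
  \<open>fact n \<le> n ^ n \<le> 2 ^ (l * n)\<close> to less than one.
\<close>

lemma h_fact_le: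
  assumes K: "K \<ge> 2" and W: "W = K * (K + 1)" and J: "J = W * 2 ^ K * l"
    and n: "n \<ge> 1" "W * (K * 2 ^ (K + 3) + 2 ^ K) \<le> n" "n \<le> 2 ^ l" "2 * J \<le> n" and l: "l < 2 * W"
  shows "h (fact n) \<le> 2 * J + 1 + (l * n div (W div 2) + 1)"
proof (rule h_le_of_dense_divisors)
  let ?e = "(1 / 2 :: real) ^ (W div 2)"
  have "2 * 3 \<le> W" unfolding W using K by (intro mult_le_mono) auto
  then have W3: "W div 2 \<ge> 3" by simp
  have "?e \<le> (1 / 2) ^ 3" using W3 by (intro power_decreasing) auto
  then show "?e < 1 / 2" by (simp add: power3_eq_cube)
  have "2 ^ J dvd (fact (2 * J) :: nat)" by (rule two_power_dvd_fact)
  also have "\<dots> dvd fact n" using n by (intro fact_dvd) auto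
  finally show "2 ^ J dvd (fact n :: nat)" .
  have nl: "real n \<le> 2 ^ l" using n(3) by (metis of_nat_le_iff of_nat_numeral of_nat_power)
  have "real n \<le> 2 * fact (2 * W - 1)"
  proof -
    have "(2::real) ^ l \<le> 2 ^ (2 * W - 1)" using l by (intro power_increasing) auto
    with nl two_power_le_fact[of "2 * W - 1"] show ?thesis by linarith
  qed
  note near = divisor_of_fact_near[OF _ W n(2) this]
  have lnn: "ln (real n) \<le> real l * ln 2"
    using nl n(1) by (metis ln_le_cancel_iff ln_realpow less_le_trans of_nat_0_less_iff zero_less_one zero_less_numeral zero_less_power)
  have lnJ: "real W * 2 ^ K * ln (real n) \<le> real J * ln 2"
  proof -
    have "real W * 2 ^ K * ln (real n) \<le> real W * 2 ^ K * (real l * ln 2)"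
      using lnn by (intro mult_left_mono) auto
    then show ?thesis by (simp add: J mult_ac)
  qed
  show "\<exists>d. d dvd fact n \<and> d \<le> m \<and> real (m - d) \<le> ?e * real m"
    if m: "2 ^ J \<le> m" "m * 2 ^ J \<le> fact n" for m
  proof -
    have m0: "m > 0" using m(1) by (intro Nat.gr0I) auto
    have "2 ^ J \<le> real m" using m(1) by (metis of_nat_le_iff of_nat_numeral of_nat_power)
    then have "ln (2 ^ J) \<le> ln (real m)" using m0 by (subst ln_le_cancel_iff) auto
    then have 1: "real W * 2 ^ K * ln (real n) \<le> ln (real m)"
      using lnJ by (simp add: ln_realpow)
    have "real m * 2 ^ J \<le> fact n"
      using m(2) of_nat_le_iff[where 'a=real, of "m * 2 ^ J" "fact n"] by simp
    then have "ln (real m * 2 ^ J) \<le> ln (fact n)" using m0 by (subst ln_le_cancel_iff) auto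
    then have 2: "ln (real m) \<le> ln (fact n) - real W * 2 ^ K * ln (real n)"
      using lnJ m0 by (simp add: ln_mult_pos ln_realpow)
    have "1 \<le> K" using K by simp
    from near[OF this 1 2] obtain d where d: "d dvd fact n" "ln (real d) \<le> ln (real m)" "ln (real m) \<le> ln (real d) + ?e"
      by blast
    have d0: "d > 0" using d(1) by (auto intro!: Nat.gr0I)
    have dm: "d \<le> m" using d(2) d0 m0 by simp
    have "real m * exp (- ?e) = exp (ln (real m) + - ?e)"
      using m0 by (simp only: exp_add exp_ln of_nat_0_less_iff)
    also have "\<dots> \<le> exp (ln (real d))"
      using d(3) by (subst exp_le_cancel_iff) linarith
    also have "\<dots> = real d" using d0 by simp
    finally have "real m * exp (- ?e) \<le> real d" .
    moreover have "real m * (1 + (- ?e)) \<le> real m * exp (- ?e)"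
      by (intro mult_left_mono exp_ge_add_one_self) auto
    ultimately show ?thesis
      using d(1) dm by (intro exI[of _ d]) (auto simp: of_nat_diff algebra_simps)
  qed
  show "real (fact n) * ?e ^ (l * n div (W div 2) + 1) < 2 ^ J"
  proof -
    have "l * n < W div 2 * (l * n div (W div 2) + 1)"
      using W3 by (metis Suc_eq_plus1 dividend_less_times_div less_le_trans zero_less_numeral mult_Suc_right)
    then have "?e ^ (l * n div (W div 2) + 1) < (1 / 2) ^ (l * n)"
      unfolding power_mult[symmetric] by (intro power_strict_decreasing) auto
    then have "real (fact n) * ?e ^ (l * n div (W div 2) + 1) < real (fact n) * (1 / 2) ^ (l * n)"
      by (intro mult_strict_left_mono) auto
    also have "\<dots> \<le> 2 ^ (l * n) * (1 / 2) ^ (l * n)"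
    proof (intro mult_right_mono)
      have "(fact n :: real) \<le> real n ^ n" using fact_le_power[of n] by simp
      also have "\<dots> \<le> (2 ^ l) ^ n" using nl by (intro power_mono) auto
      finally show "real (fact n) \<le> 2 ^ (l * n)" by (simp add: power_mult)
    qed simp
    also have "\<dots> = 1" by (simp add: power_one_over)
    also have "\<dots> \<le> 2 ^ J" by simp
    finally show ?thesis .
  qed
qed auto

theorem theorem1:
  shows "\<forall>\<delta>::real. \<delta> > 0 \<longrightarrow>
    (\<exists>n0::nat. \<forall>n::nat. n \<ge> n0 \<longrightarrow>
      real (h (fact n)) \<le> (2 * ln 2 + \<delta>) * (real n / ln (real n)))"
proof (intro allI impI)
  fix \<delta> :: real assume "\<delta> > 0"
  define L where "L = (\<lambda>n::nat. ln (real n) / ln 2)"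
  \<comment> \<open>the sixth power of the logarithm makes \<open>J\<close>, roughly \<open>2 ^ K\<close> times its cube, negligible\<close>
  define k where "k = (\<lambda>n. L n - 6 * (ln (L n) / ln 2))"
  \<comment> \<open>an upper bound for \<open>2 * J + 1 + s\<close>; only its last summand contributes to the limit\<close>
  define b where "b = (\<lambda>n. 2 * (L n * (L n + 1) * (real n / L n ^ 6) * (L n + 1)) + 2
      + 2 * (L n + 1) * real n / ((k n - 1) * k n))"
  have "(\<lambda>n. b n * (ln (real n) / real n)) \<longlonglongrightarrow> 2 * ln 2"
    unfolding b_def k_def L_def by real_asymp
  then have ev1: "eventually (\<lambda>n. b n * (ln (real n) / real n) < 2 * ln 2 + \<delta>) sequentially"
    using \<open>\<delta> > 0\<close> by (intro order_tendstoD(2)) auto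
  have ev2: "eventually (\<lambda>n. k n \<ge> 3) sequentially"
    unfolding k_def L_def by real_asymp
  have ev3: "eventually (\<lambda>n. L n \<ge> 1) sequentially"
    unfolding L_def by real_asymp
  have ev4: "eventually (\<lambda>n. L n * (L n + 1) * (L n * 8 + 1) * (real n / L n ^ 6) \<le> real n) sequentially"
    unfolding L_def by real_asymp
  have ev5: "eventually (\<lambda>n. 2 * (L n * (L n + 1) * (real n / L n ^ 6) * (L n + 1)) \<le> real n) sequentially"
    unfolding L_def by real_asymp
  have ev6: "eventually (\<lambda>n. L n + 1 < 2 * ((k n - 1) * k n)) sequentially"
    unfolding k_def L_def by real_asymp
  have "eventually (\<lambda>n. real (h (fact n)) \<le> (2 * ln 2 + \<delta>) * (real n / ln (real n))) sequentially"
    using ev1 ev2 ev3 ev4 ev5 ev6 eventually_ge_at_top[of 2]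
  proof eventually_elim
    case (elim n)
    define K where "K = nat \<lfloor>k n\<rfloor>"
    define l where "l = nat \<lceil>L n\<rceil>"
    define W where "W = K * (K + 1)"
    define J where "J = W * 2 ^ K * l"
    have L1: "L n \<ge> 1" by fact
    have n0: "real n > 0" using elim by simp
    have K: "real K \<le> k n" "k n - 1 \<le> real K" "K \<ge> 2"
      using elim unfolding K_def by linarith+
    have l: "L n \<le> real l" "real l \<le> L n + 1"
      using L1 unfolding l_def by linarith+
    have "ln (L n) / ln 2 \<ge> 0" using L1 by simp
    then have KL: "real K \<le> L n" using K(1) unfolding k_def by simp
    have nL: "2 powr (L n) = real n"
      using n0 by (simp add: L_def powr_def)
    have K2: "2 ^ K \<le> real n / L n ^ 6"
    proof -
      have "(2::real) ^ K = 2 powr real K" by (simp add: powr_realpow)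
      also have "\<dots> \<le> 2 powr (k n)" using K(1) by simp
      also have "\<dots> = 2 powr L n / (2 powr (ln (L n) / ln 2)) powr 6"
        unfolding k_def by (simp add: powr_diff powr_powr mult.commute)
      also have "2 powr (ln (L n) / ln 2) = L n" using L1 by (simp add: powr_def)
      also have "L n powr 6 = L n ^ 6" using L1 by (simp add: powr_numeral)
      finally show ?thesis using nL by simp
    qed
    have Wle: "real W \<le> L n * (L n + 1)"
    proof -
      have "real K * (real K + 1) \<le> L n * (L n + 1)"
        using KL L1 by (intro mult_mono) auto
      then show ?thesis by (simp add: W_def algebra_simps)
    qed
    have Wge: "(k n - 1) * k n \<le> real W"
    proof -
      have "(k n - 1) * k n \<le> real K * (real K + 1)"
        using K elim by (intro mult_mono) linarith+
      then show ?thesis by (simp add: W_def algebra_simps)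
    qed
    have Jle: "real J \<le> L n * (L n + 1) * (real n / L n ^ 6) * (L n + 1)"
      unfolding J_def of_nat_mult of_nat_power using Wle K2 l L1
      by (intro mult_mono) auto
    have "h (fact n) \<le> 2 * J + 1 + (l * n div (W div 2) + 1)"
    proof (rule h_fact_le[OF K(3) W_def J_def])
      have "real (W * (K * 2 ^ (K + 3) + 2 ^ K)) = real W * (real K * 8 + 1) * 2 ^ K"
        by (simp add: algebra_simps power_add)
      also have "\<dots> \<le> L n * (L n + 1) * (L n * 8 + 1) * (real n / L n ^ 6)"
        using Wle KL K2 L1 by (intro mult_mono) auto
      also have "\<dots> \<le> real n" by fact
      finally show "W * (K * 2 ^ (K + 3) + 2 ^ K) \<le> n" by (simp only: of_nat_le_iff)
      have "real n \<le> 2 powr real l" using nL l by (metis one_le_numeral powr_mono)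
      then have "real n \<le> real (2 ^ l)" by (simp add: powr_realpow)
      then show "n \<le> 2 ^ l" by (simp only: of_nat_le_iff)
      have "real (2 * J) \<le> real n" using Jle elim by simp
      then show "2 * J \<le> n" by (simp only: of_nat_le_iff)
      have "real l < real (2 * W)" using l Wge elim by simp
      then show "l < 2 * W" by (simp only: of_nat_less_iff)
    qed (use elim in simp)
    then have "real (h (fact n)) \<le> 2 * real J + 2 + real (l * n div (W div 2))"
      by (simp add: of_nat_le_iff[symmetric, where 'a=real] del: of_nat_le_iff)
    also have "real (l * n div (W div 2)) \<le> 2 * (L n + 1) * real n / ((k n - 1) * k n)"
    proof -
      have "real (l * n div (W div 2)) \<le> real (l * n) / real (W div 2)"
        by (rule of_nat_div_le_of_nat)
      also have "real (W div 2) = real W / 2"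
        unfolding W_def by (subst real_of_nat_div) (auto simp: even_mult_iff)
      also have "real (l * n) / (real W / 2) = 2 * real l * real n / real W"
        by simp
      also have "\<dots> \<le> 2 * (L n + 1) * real n / ((k n - 1) * k n)"
        using l Wge elim by (intro frac_le mult_mono mult_pos_pos) auto
      finally show ?thesis .
    qed
    also have "2 * real J + 2 + 2 * (L n + 1) * real n / ((k n - 1) * k n) \<le> b n"
      using Jle by (simp add: b_def)
    also have "b n \<le> (2 * ln 2 + \<delta>) * (real n / ln (real n))"
      using elim(1) elim(7) by (simp add: field_simps)
    finally show ?case by simp
  qed
  then show "\<exists>n0. \<forall>n\<ge>n0. real (h (fact n)) \<le> (2 * ln 2 + \<delta>) * (real n / ln (real n))"
    by (simp add: eventually_at_top_linorder)
qed

end
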